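(* Let $\kappa$ and $\lambda$ be cardinals with $\operatorname{cf}(\kappa)=\kappa$. Then there is a 0-dimensional Hausdorff space $D$ such that $\chi(D)=\kappa$, $\operatorname{nw}(D)=\lambda^{<\kappa}$ and $\operatorname{w}(D)=\lambda^{\kappa}$.
   Context: $\chi$ denotes character, $\operatorname{nw}$ network weight and $\operatorname{w}$ weight; $\lambda^{<\kappa}=\sup_{\mu<\kappa}\lambda^\mu$ (cardinal exponentiation). *)

theory Defs
  imports "HOL-Analysis.Analysis"
begin

text \<open>
  Cardinals are the cardinal orders of \<open>HOL.BNF_Cardinal_Order_Relation\<close>, and
  equality of cardinals is order isomorphism, \<open>=o\<close>.
\<close>

unbundle cardinal_syntax

text \<open>
  The minimum of the cardinalities of the members of \<open>\<A>\<close>. It is attained since cardinals are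
  well-ordered; nothing is claimed for \<open>\<A> = {}\<close>.
\<close>

definition min_card :: "'c set set \<Rightarrow> 'c rel" where
  "min_card \<A> = |SOME A. A \<in> \<A> \<and> (\<forall>B\<in>\<A>. |A| \<le>o |B| )|"

lemma min_card_attained:
  assumes "\<A> \<noteq> {}"
  shows "\<exists>A\<in>\<A>. min_card \<A> = |A| \<and> (\<forall>B\<in>\<A>. |A| \<le>o |B| )"
proof -
  have "\<exists>r\<in>card_of ` \<A>. \<forall>r'\<in>card_of ` \<A>. r \<le>o r'"
    using assms by (intro exists_minim_Card_order) (auto simp: card_of_Card_order)
  then have "\<exists>A. A \<in> \<A> \<and> (\<forall>B\<in>\<A>. |A| \<le>o |B| )"
    by auto
  from someI_ex[OF this] show ?thesis
    unfolding min_card_def by blast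
qed

text \<open>
  The supremum of a set of cardinals living on one type. The type itself is large enough to carry
  an upper bound, so the family of candidates is not empty.
\<close>

definition csup :: "'c rel set \<Rightarrow> 'c rel" where
  "csup R = min_card {A. \<forall>r\<in>R. r \<le>o |A| }"

lemma csup_least_upper_bound:
  fixes R :: "'c rel set"
  assumes "\<And>r. r \<in> R \<Longrightarrow> Card_order r"
  shows "\<And>r. r \<in> R \<Longrightarrow> r \<le>o csup R"
    and "\<And>A :: 'c set. (\<And>r. r \<in> R \<Longrightarrow> r \<le>o |A| ) \<Longrightarrow> csup R \<le>o |A|"
proof -
  have "r \<le>o |UNIV :: 'c set|" if "r \<in> R" for r
    using ordIso_ordLeq_trans[OF ordIso_symmetric[OF card_of_Field_ordIso[OF assms[OF that]]]
        card_of_mono1[OF subset_UNIV]] .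
  then have "{A :: 'c set. \<forall>r\<in>R. r \<le>o |A| } \<noteq> {}"
    by blast
  from min_card_attained[OF this]
  show "\<And>r. r \<in> R \<Longrightarrow> r \<le>o csup R"
    and "\<And>A :: 'c set. (\<And>r. r \<in> R \<Longrightarrow> r \<le>o |A| ) \<Longrightarrow> csup R \<le>o |A|"
    unfolding csup_def by auto
qed

text \<open>
  Cofinality. Cofinal sets are taken in the weak sense (every element is below or equal to some
  element of the set), so that the value is meaningful for every well-order; the library's
  \<open>cofinal\<close> is the strict version, which agrees with it for infinite cardinals.
\<close>

definition cf :: "'c rel \<Rightarrow> 'c rel" where
  "cf \<kappa> = min_card {A. A \<subseteq> Field \<kappa> \<and> (\<forall>a\<in>Field \<kappa>. \<exists>b\<in>A. (a, b) \<in> \<kappa>)}"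

lemma cf_eq_iff_regularCard:
  assumes "Cinfinite \<kappa>"
  shows "cf \<kappa> =o \<kappa> \<longleftrightarrow> regularCard \<kappa>"
proof -
  let ?\<A> = "{A. A \<subseteq> Field \<kappa> \<and> (\<forall>a\<in>Field \<kappa>. \<exists>b\<in>A. (a, b) \<in> \<kappa>)}"
  have wo: "Well_order \<kappa>"
    using assms by (simp add: card_order_on_well_order_on)
  then have refl: "(a, a) \<in> \<kappa>" if "a \<in> Field \<kappa>" for a
    using that by (simp add: order_on_defs refl_on_def)
  have trans: "trans \<kappa>" and antisym: "antisym \<kappa>"
    using wo by (simp_all add: order_on_defs)
  have cofinal: "A \<in> ?\<A> \<longleftrightarrow> A \<subseteq> Field \<kappa> \<and> cofinal A \<kappa>" for A
  proof (intro iffI)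
    assume A: "A \<in> ?\<A>"
    have "\<exists>b\<in>A. a \<noteq> b \<and> (a, b) \<in> \<kappa>" if a: "a \<in> Field \<kappa>" for a
    proof -
      obtain c where c: "c \<in> Field \<kappa>" "a \<noteq> c" "(a, c) \<in> \<kappa>"
        using infinite_Card_order_limit[OF _ _ a] assms unfolding cinfinite_def by blast
      obtain b where b: "b \<in> A" "(c, b) \<in> \<kappa>"
        using A c(1) by blast
      have "(a, b) \<in> \<kappa>"
        using transD[OF trans c(3) b(2)] .
      moreover have "a \<noteq> b"
        using antisymD[OF antisym c(3)] b(2) c(2) by blast
      ultimately show ?thesis
        using b(1) by blast
    qed
    with A show "A \<subseteq> Field \<kappa> \<and> cofinal A \<kappa>"
      by (simp add: cofinal_def)
  next
    assume "A \<subseteq> Field \<kappa> \<and> cofinal A \<kappa>"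
    then show "A \<in> ?\<A>"
      unfolding cofinal_def by blast
  qed
  have "Field \<kappa> \<in> ?\<A>"
    using refl by blast
  then have "?\<A> \<noteq> {}"
    by (metis empty_iff)
  from min_card_attained[OF this, folded cf_def]
  obtain A where A: "A \<in> ?\<A>" "cf \<kappa> = |A|" "\<forall>B\<in>?\<A>. |A| \<le>o |B|"
    by (elim bexE conjE)
  show ?thesis
  proof
    assume cf: "cf \<kappa> =o \<kappa>"
    have "|K| =o \<kappa>" if "K \<subseteq> Field \<kappa>" "cofinal K \<kappa>" for K
    proof -
      have "\<kappa> \<le>o |K|"
      proof (rule ordIso_ordLeq_trans[OF ordIso_symmetric[OF cf]])
        have "K \<in> ?\<A>"
          unfolding cofinal using that by (rule conjI)
        then show "cf \<kappa> \<le>o |K|"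
          unfolding A(2) by (rule A(3)[rule_format])
      qed
      moreover have "|K| \<le>o \<kappa>"
        using ordLeq_ordIso_trans[OF card_of_mono1[OF that(1)] card_of_Field_ordIso] assms by simp
      ultimately show ?thesis
        by (simp add: ordIso_iff_ordLeq)
    qed
    then show "regularCard \<kappa>"
      by (simp add: regularCard_def)
  next
    assume "regularCard \<kappa>"
    then show "cf \<kappa> =o \<kappa>"
      using A(1)[unfolded cofinal] unfolding A(2) regularCard_def by simp
  qed
qed

text \<open>
  The cardinal \<open>\<Lambda>\<^bsup><\<kappa>\<^esup>\<close>, with the supremum over all cardinals \<open>\<mu> < \<kappa>\<close>. Each of these has a
  representative on the type carrying \<open>\<kappa>\<close>, which puts all the powers on one type.
\<close>

definition cexp_less :: "'b rel \<Rightarrow> 'a rel \<Rightarrow> ('a \<Rightarrow> 'b) rel" where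
  "cexp_less \<Lambda> \<kappa> = csup {\<Lambda> ^c \<mu> | \<mu>. Card_order (\<mu> :: 'a rel) \<and> \<mu> <o \<kappa>}"

definition network :: "'c topology \<Rightarrow> 'c set set \<Rightarrow> bool" where
  "network X \<N> \<longleftrightarrow> (\<forall>N\<in>\<N>. N \<subseteq> topspace X) \<and>
     (\<forall>U x. openin X U \<and> x \<in> U \<longrightarrow> (\<exists>N\<in>\<N>. x \<in> N \<and> N \<subseteq> U))"

definition base :: "'c topology \<Rightarrow> 'c set set \<Rightarrow> bool" where
  "base X \<B> \<longleftrightarrow> (\<forall>B\<in>\<B>. openin X B) \<and>
     (\<forall>U x. openin X U \<and> x \<in> U \<longrightarrow> (\<exists>B\<in>\<B>. x \<in> B \<and> B \<subseteq> U))"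

definition local_base :: "'c topology \<Rightarrow> 'c \<Rightarrow> 'c set set \<Rightarrow> bool" where
  "local_base X x \<B> \<longleftrightarrow> (\<forall>B\<in>\<B>. openin X B \<and> x \<in> B) \<and>
     (\<forall>U. openin X U \<and> x \<in> U \<longrightarrow> (\<exists>B\<in>\<B>. B \<subseteq> U))"

definition network_weight :: "'c topology \<Rightarrow> 'c set rel" where
  "network_weight X = min_card {\<N>. network X \<N>}"

definition weight :: "'c topology \<Rightarrow> 'c set rel" where
  "weight X = min_card {\<B>. base X \<B>}"

definition character_at :: "'c topology \<Rightarrow> 'c \<Rightarrow> 'c set rel" where
  "character_at X x = min_card {\<B>. local_base X x \<B>}"

definition character :: "'c topology \<Rightarrow> 'c set rel" where
  "character X = csup (character_at X ` topspace X)"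

definition zero_dimensional_space :: "'c topology \<Rightarrow> bool" where
  "zero_dimensional_space X \<longleftrightarrow> (\<exists>\<B>. base X \<B> \<and> (\<forall>B\<in>\<B>. closedin X B))"

end

theory Submission
  imports Defs
begin

text \<open>
  The points of \<open>D\<close> are the nodes and the branches of the tree \<open>\<Lambda>\<^bsup><\<kappa>\<^esup>\<close>, coded as partial
  functions. Nodes are isolated; the neighbourhoods of a branch \<open>x\<close> are the cones above its
  restrictions with all nodes lying on \<open>x\<close> removed. The branches alone carry the usual topology of
  \<open>\<Lambda>\<^bsup>\<kappa>\<^esup>\<close>, so the cones of branches together with the singletons of nodes form a network of size
  \<open>\<Lambda>\<^bsup><\<kappa>\<^esup>\<close>. A single basic open set can serve only \<open>\<Lambda>\<^bsup><\<kappa>\<^esup>\<close> many of the \<open>\<Lambda>\<^bsup>\<kappa>\<^esup>\<close> branches, since it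
  contains nodes on every branch close enough to one of them; this forces the weight up to
  \<open>\<Lambda>\<^bsup>\<kappa>\<^esup>\<close>. Regularity of \<open>\<kappa>\<close> keeps fewer than \<open>\<kappa>\<close> many neighbourhoods from being a local base.
\<close>

section \<open>Minima and suprema of cardinals\<close>

lemma min_card_eqI:
  fixes r :: "'d rel"
  assumes "A \<in> \<A>" and "|A| \<le>o r" and "Card_order r" and "\<And>B. B \<in> \<A> \<Longrightarrow> r \<le>o |B|"
  shows "min_card \<A> =o r"
proof -
  obtain C where C: "C \<in> \<A>" "min_card \<A> = |C|" "\<forall>B\<in>\<A>. |C| \<le>o |B|"
    using min_card_attained[of \<A>] assms(1) by blast
  have "|C| \<le>o r"
    using C(3) assms(1,2) ordLeq_transitive by blast
  then show ?thesis
    using C assms(4) by (simp add: ordIso_iff_ordLeq)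
qed

lemma Card_order_csup: "Card_order (csup R)"
  by (simp add: csup_def min_card_def card_of_Card_order)

text \<open>By definition \<open>csup R\<close> is least only among sets of the type
  \<open>'c\<close>. A bound \<open>B\<close> on another type that were strictly smaller would have
  an equinumerous copy on \<open>'c\<close>, contradicting leastness there.\<close>

lemma csup_ordLeq:
  fixes R :: "'c rel set" and B :: "'d set"
  assumes "\<And>r. r \<in> R \<Longrightarrow> Card_order r" and "\<And>r. r \<in> R \<Longrightarrow> r \<le>o |B|"
  shows "csup R \<le>o |B|"
proof (rule ccontr)
  assume "\<not> csup R \<le>o |B|"
  then have less: "|B| <o csup R"
    using Card_order_csup not_ordLeq_iff_ordLess card_order_on_well_order_on card_of_Well_order
    by blast
  then obtain B' :: "'c set" where B': "|B| =o |B'|"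
    using internalize_card_of_ordLess[of B "csup R"] by blast
  have "csup R \<le>o |B'|"
    using assms B' ordLeq_ordIso_trans by (blast intro: csup_least_upper_bound(2))
  then show False
    using less B' not_ordLess_ordLeq ordLess_ordLeq_trans ordIso_iff_ordLeq by blast
qed

section \<open>Partial functions with a prescribed domain\<close>

text \<open>Partial functions, rather than \<open>Func\<close>, put nodes of all levels and branches
  on one type, with \<open>\<subseteq>\<^sub>m\<close> as the tree order.\<close>

definition maps_on :: "'a set \<Rightarrow> 'b set \<Rightarrow> ('a \<rightharpoonup> 'b) set" where
  "maps_on A B = {f. dom f = A \<and> ran f \<subseteq> B}"

lemma maps_on_eq_Some:
  assumes "f \<in> maps_on A B" and "a \<in> A"
  shows "\<exists>b\<in>B. f a = Some b"
  using assms by (auto simp: maps_on_def ran_def dom_def)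

lemma maps_on_eq_None: "f \<in> maps_on A B \<Longrightarrow> a \<notin> A \<Longrightarrow> f a = None"
  by (auto simp: maps_on_def)

lemma card_of_maps_on: "|maps_on A B| =o |Func A B|"
proof (rule card_of_ordIsoI[OF bij_betw_byWitness])
  let ?f = "\<lambda>f a. if a \<in> A then the (f a) else undefined"
  let ?g = "\<lambda>f a. if a \<in> A then Some (f a) else None"
  show "\<forall>f\<in>maps_on A B. ?g (?f f) = f"
    by (fastforce simp: maps_on_eq_None dest: maps_on_eq_Some)
  show "\<forall>f\<in>Func A B. ?f (?g f) = f"
    by (auto simp: Func_def)
  show "?f ` maps_on A B \<subseteq> Func A B"
    by (auto simp: Func_def dest: maps_on_eq_Some)
  show "?g ` Func A B \<subseteq> maps_on A B"
    by (auto simp: Func_def maps_on_def ran_def split: if_splits)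
qed

lemma network_if_base: "base X \<B> \<Longrightarrow> network X \<B>"
  by (auto simp: base_def network_def dest: openin_subset)

section \<open>Regularity and bounded sets of levels\<close>

locale regular_tree =
  fixes \<kappa> :: "'a rel" and \<Lambda> :: "'b rel"
  assumes Cinfinite: "Cinfinite \<kappa>" and cf: "cf \<kappa> =o \<kappa>"
    and Card_order: "Card_order \<Lambda>" and ctwo: "ctwo \<le>o \<Lambda>"
begin

lemma infinite_Field: "infinite (Field \<kappa>)"
  using Cinfinite by (simp add: cinfinite_def)

lemma Well_order: "Well_order \<kappa>"
  using Cinfinite by (simp add: card_order_on_well_order_on)

lemma underS_mono: "a \<in> underS \<kappa> b \<Longrightarrow> underS \<kappa> a \<subseteq> underS \<kappa> b"
  using Well_order unfolding order_on_defs underS_def trans_def antisym_def by blast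

lemma underS_neq_Field: "a \<in> Field \<kappa> \<Longrightarrow> underS \<kappa> a \<noteq> Field \<kappa>"
  using underS_notIn[of a \<kappa>] by metis

text \<open>This is where regularity enters: a set of fewer than \<kappa> elements cannot be
  cofinal.\<close>

lemma bounded:
  assumes A: "A \<subseteq> Field \<kappa>" "|A| <o \<kappa>"
  obtains b where "b \<in> Field \<kappa>" "A \<subseteq> underS \<kappa> b"
proof -
  have "regularCard \<kappa>"
    using cf cf_eq_iff_regularCard[OF Cinfinite] by blast
  then have "\<not> cofinal A \<kappa>"
    using A not_ordLess_ordIso unfolding regularCard_def by blast
  then obtain a where a: "a \<in> Field \<kappa>" "\<And>b. b \<in> A \<Longrightarrow> \<not> (a \<noteq> b \<and> (a, b) \<in> \<kappa>)"
    unfolding cofinal_def by blast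
  \<comment> \<open>Failure of cofinality only puts \<open>A\<close> weakly below \<open>a\<close>;
    as \<open>underS\<close> is strict, a step beyond \<open>a\<close> is needed, which exists since
    \<kappa> is a limit.\<close>
  obtain c where c: "c \<in> Field \<kappa>" "a \<noteq> c" "(a, c) \<in> \<kappa>"
    using infinite_Card_order_limit[OF _ infinite_Field a(1)] Cinfinite by blast
  have "b \<in> underS \<kappa> c" if "b \<in> A" for b
  proof (cases "a = b")
    case False
    then have "(b, a) \<in> \<kappa>"
      using a that A(1) Well_order unfolding order_on_defs total_on_def by blast
    then have "b \<in> underS \<kappa> a"
      using False by (simp add: underS_def)
    then show ?thesis
      using underS_mono[of a c] c by (auto simp: underS_def)
  qed (use c in \<open>simp add: underS_def\<close>)
  with c(1) show thesis
    by (auto intro: that)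
qed

lemma bounded_finite:
  assumes "A \<subseteq> Field \<kappa>" "finite A"
  obtains b where "b \<in> Field \<kappa>" "A \<subseteq> underS \<kappa> b"
proof (rule bounded)
  show "|A| <o \<kappa>"
    by (rule finite_ordLess_infinite)
      (use assms infinite_Field Well_order card_of_Well_order[of A] in \<open>auto simp: Field_card_of\<close>)
qed (use assms in auto)

section \<open>The tree and its topology\<close>

definition branches :: "('a \<rightharpoonup> 'b) set" where
  "branches = maps_on (Field \<kappa>) (Field \<Lambda>)"

text \<open>As \<kappa> is a cardinal, each \<open>underS \<kappa> a\<close> has fewer than \<kappa>
  elements, and every cardinal below \<kappa> is the size of one of them.\<close>

definition level :: "'a \<Rightarrow> ('a \<rightharpoonup> 'b) set" where
  "level a = maps_on (underS \<kappa> a) (Field \<Lambda>)"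

definition nodes :: "('a \<rightharpoonup> 'b) set" where
  "nodes = (\<Union>a\<in>Field \<kappa>. level a)"

text \<open>
  A neighbourhood of the branch \<open>x\<close> omits all the nodes on \<open>x\<close> itself, although such nodes
  lie in every neighbourhood of the other branches passing through them.
\<close>

definition nbhd :: "'a \<Rightarrow> ('a \<rightharpoonup> 'b) \<Rightarrow> ('a \<rightharpoonup> 'b) set" where
  "nbhd a x = {y \<in> branches \<union> nodes. (\<forall>b\<in>underS \<kappa> a. y b = x b) \<and> (y \<subseteq>\<^sub>m x \<longrightarrow> y = x)}"

text \<open>Only branches impose a condition, so every set of nodes is open.\<close>

definition tree_space :: "('a \<rightharpoonup> 'b) topology" where
  "tree_space = topology (\<lambda>U. U \<subseteq> branches \<union> nodes \<and>
     (\<forall>x\<in>U \<inter> branches. \<exists>a\<in>Field \<kappa>. nbhd a x \<subseteq> U))"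

lemma branches_nodes_disjoint: "branches \<inter> nodes = {}"
  using underS_neq_Field by (auto simp: branches_def nodes_def level_def maps_on_def)

lemma branch_eq_Some: "x \<in> branches \<Longrightarrow> a \<in> Field \<kappa> \<Longrightarrow> \<exists>v. x a = Some v"
  unfolding branches_def by (drule maps_on_eq_Some) auto

lemma branch_neq:
  assumes "x \<in> branches" "y \<in> branches" "x \<noteq> y"
  obtains b where "b \<in> Field \<kappa>" "x b \<noteq> y b"
  using assms unfolding branches_def by (metis ext maps_on_eq_None)

lemma restrict_branch:
  assumes "x \<in> branches" "a \<in> Field \<kappa>"
  shows "x |` underS \<kappa> a \<in> level a"
proof -
  have "ran (x |` underS \<kappa> a) \<subseteq> ran x"
    by (auto simp: ran_def restrict_map_def split: if_splits)
  then show ?thesis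
    using assms Order_Relation.underS_Field[of \<kappa> a]
    unfolding branches_def level_def maps_on_def by auto
qed

lemma two_labels:
  obtains v w where "v \<in> Field \<Lambda>" "w \<in> Field \<Lambda>" "v \<noteq> w"
proof -
  have "|UNIV :: bool set| \<le>o |Field \<Lambda>|"
    using card_of_mono2[OF ctwo] by (simp add: ctwo_def Field_card_of)
  then obtain f :: "bool \<Rightarrow> 'b" where "inj f" "range f \<subseteq> Field \<Lambda>"
    using card_of_ordLeq[of "UNIV :: bool set" "Field \<Lambda>"] by auto
  then show thesis
    by (intro that[of "f True" "f False"]) (auto simp: inj_eq)
qed

lemma extend_node:
  assumes "s \<in> level a"
  obtains x where "x \<in> branches" "\<And>b. b \<in> underS \<kappa> a \<Longrightarrow> x b = s b"
proof -
  obtain v where "v \<in> Field \<Lambda>"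
    using two_labels by blast
  then have "(\<lambda>b. if b \<in> Field \<kappa> then Some v else None) ++ s \<in> branches"
    using assms Order_Relation.underS_Field[of \<kappa> a]
    by (auto simp: branches_def level_def maps_on_def ran_def map_add_def dom_def
        split: option.splits if_splits)
  moreover have "((\<lambda>b. if b \<in> Field \<kappa> then Some v else None) ++ s) b = s b"
    if "b \<in> underS \<kappa> a" for b
    using maps_on_eq_Some[OF assms[unfolded level_def] that] by (auto simp: map_add_def)
  ultimately show thesis
    by (rule that)
qed

lemma branches_nonempty: "branches \<noteq> {}"
proof -
  obtain v where "v \<in> Field \<Lambda>"
    using two_labels by blast
  then have "(\<lambda>b. if b \<in> Field \<kappa> then Some v else None) \<in> branches"
    by (auto simp: branches_def maps_on_def ran_def dom_def split: if_splits)
  then show ?thesis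
    by blast
qed

section \<open>Neighbourhoods of branches\<close>

lemma nbhd_mono: "underS \<kappa> a \<subseteq> underS \<kappa> b \<Longrightarrow> nbhd b x \<subseteq> nbhd a x"
  by (auto simp: nbhd_def)

lemma mem_nbhd_self: "x \<in> branches \<Longrightarrow> x \<in> nbhd a x"
  by (simp add: nbhd_def)

lemma nbhd_subset: "nbhd a x \<subseteq> branches \<union> nodes"
  by (auto simp: nbhd_def)

text \<open>Branches are defined on all of \<open>Field \<kappa>\<close>, so none lies properly
  below another; the clause that omits nodes on \<open>x\<close> is vacuous for them.\<close>

lemma branch_in_nbhd_iff:
  assumes "x \<in> branches" "y \<in> branches"
  shows "y \<in> nbhd a x \<longleftrightarrow> (\<forall>b\<in>underS \<kappa> a. y b = x b)"
proof -
  have "y = x" if "y \<subseteq>\<^sub>m x"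
  proof (rule ccontr)
    assume "y \<noteq> x"
    then obtain b where "b \<in> Field \<kappa>" "y b \<noteq> x b"
      using branch_neq assms by metis
    then show False
      using that branch_eq_Some[OF assms(2)] by (fastforce simp: map_le_def)
  qed
  then show ?thesis
    using assms by (auto simp: nbhd_def)
qed

lemma nbhd_disjoint: "b \<in> underS \<kappa> a \<Longrightarrow> x b \<noteq> y b \<Longrightarrow> nbhd a x \<inter> nbhd a y = {}"
proof (rule equals0I)
  fix z
  assume b: "b \<in> underS \<kappa> a" "x b \<noteq> y b" and "z \<in> nbhd a x \<inter> nbhd a y"
  then have "z b = x b" "z b = y b"
    unfolding nbhd_def by blast+
  with b(2) show False
    by simp
qed

lemma nbhd_directed:
  assumes "a \<in> Field \<kappa>" "b \<in> Field \<kappa>"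
  obtains c where "c \<in> Field \<kappa>" "nbhd c x \<subseteq> nbhd a x" "nbhd c x \<subseteq> nbhd b x"
proof -
  obtain c where "c \<in> Field \<kappa>" "{a, b} \<subseteq> underS \<kappa> c"
    using bounded_finite[of "{a, b}"] assms by blast
  then show thesis
    by (intro that[of c] nbhd_mono underS_mono) auto
qed

section \<open>Clopen base and Hausdorff separation\<close>

lemma openin_tree_space:
  "openin tree_space U \<longleftrightarrow>
     U \<subseteq> branches \<union> nodes \<and> (\<forall>x\<in>U \<inter> branches. \<exists>a\<in>Field \<kappa>. nbhd a x \<subseteq> U)"
proof -
  let ?open = "\<lambda>U. U \<subseteq> branches \<union> nodes \<and>
      (\<forall>x\<in>U \<inter> branches. \<exists>a\<in>Field \<kappa>. nbhd a x \<subseteq> U)"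
  have "?open (U \<inter> V)" if U: "?open U" and V: "?open V" for U V
  proof (intro conjI ballI)
    fix x
    assume x: "x \<in> U \<inter> V \<inter> branches"
    obtain a where a: "a \<in> Field \<kappa>" "nbhd a x \<subseteq> U"
      using U x by blast
    obtain b where b: "b \<in> Field \<kappa>" "nbhd b x \<subseteq> V"
      using V x by blast
    obtain c where "c \<in> Field \<kappa>" "nbhd c x \<subseteq> nbhd a x" "nbhd c x \<subseteq> nbhd b x"
      using nbhd_directed a(1) b(1) by metis
    with a b show "\<exists>a\<in>Field \<kappa>. nbhd a x \<subseteq> U \<inter> V"
      by blast
  qed (use U in blast)
  moreover have "?open (\<Union>\<K>)" if \<K>: "\<forall>K\<in>\<K>. ?open K" for \<K>
  proof (intro conjI ballI)
    show "\<Union>\<K> \<subseteq> branches \<union> nodes"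
      using \<K> by blast
    fix x
    assume "x \<in> \<Union>\<K> \<inter> branches"
    then obtain K where K: "K \<in> \<K>" "x \<in> K \<inter> branches"
      by blast
    then obtain a where "a \<in> Field \<kappa>" "nbhd a x \<subseteq> K"
      using \<K> by blast
    with K show "\<exists>a\<in>Field \<kappa>. nbhd a x \<subseteq> \<Union>\<K>"
      by blast
  qed
  ultimately have "istopology ?open"
    unfolding istopology_def by blast
  then show ?thesis
    by (simp add: tree_space_def)
qed

lemma topspace_tree_space: "topspace tree_space = branches \<union> nodes"
proof -
  have "openin tree_space (branches \<union> nodes)"
    unfolding openin_tree_space using infinite_Field nbhd_subset
    by (metis ex_in_conv finite.emptyI order_refl)
  then show ?thesis
    using openin_topspace[of tree_space, unfolded openin_tree_space] openin_subset
    by (intro subset_antisym) (auto simp: subset_iff)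
qed

text \<open>The omitted nodes on \<open>x\<close> are the only obstacle. Around another branch
  \<open>y\<close>, a cone reaching past a point \<open>d\<close> where \<open>y\<close> and
  \<open>x\<close> differ contains no node on \<open>x\<close>.\<close>

lemma openin_nbhd:
  assumes x: "x \<in> branches" and a: "a \<in> Field \<kappa>"
  shows "openin tree_space (nbhd a x)"
  unfolding openin_tree_space
proof (intro conjI ballI nbhd_subset)
  fix y
  assume y: "y \<in> nbhd a x \<inter> branches"
  show "\<exists>b\<in>Field \<kappa>. nbhd b y \<subseteq> nbhd a x"
  proof (cases "y = x")
    case False
    then obtain d where d: "d \<in> Field \<kappa>" "y d \<noteq> x d"
      using branch_neq x y by (metis IntD2)
    obtain b where b: "b \<in> Field \<kappa>" "{a, d} \<subseteq> underS \<kappa> b"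
      using bounded_finite[of "{a, d}"] a d by blast
    have "z \<in> nbhd a x" if z: "z \<in> nbhd b y" for z
    proof -
      have "z d = y d"
        using z b by (simp add: nbhd_def)
      moreover obtain v where "y d = Some v"
        using branch_eq_Some y d by blast
      ultimately have "\<not> z \<subseteq>\<^sub>m x"
        using d(2) by (metis domI map_le_def)
      then show ?thesis
        using z y underS_mono[of a b] b by (auto simp: nbhd_def)
    qed
    with b(1) show ?thesis
      by blast
  qed (use a in auto)
qed

text \<open>Nodes are isolated, so only branches outside matter; such a branch disagrees with
  \<open>x\<close> below \<open>a\<close>, and its own cone at \<open>a\<close> is disjoint from
  that of \<open>x\<close>.\<close>

lemma closedin_nbhd:
  assumes x: "x \<in> branches" and a: "a \<in> Field \<kappa>"
  shows "closedin tree_space (nbhd a x)"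
proof -
  have "\<exists>b\<in>Field \<kappa>. nbhd b y \<subseteq> (branches \<union> nodes) - nbhd a x"
    if y: "y \<in> branches" "y \<notin> nbhd a x" for y
  proof -
    obtain b where "b \<in> underS \<kappa> a" "y b \<noteq> x b"
      using y(2) branch_in_nbhd_iff[OF x y(1)] by blast
    then have "nbhd a y \<inter> nbhd a x = {}"
      by (rule nbhd_disjoint)
    with a nbhd_subset show ?thesis
      by blast
  qed
  then show ?thesis
    using nbhd_subset by (auto simp: closedin_def topspace_tree_space openin_tree_space)
qed

lemma openin_node: "s \<in> nodes \<Longrightarrow> openin tree_space {s}"
  unfolding openin_tree_space using branches_nodes_disjoint by blast

text \<open>A node of level \<open>b\<close> is undefined at \<open>b\<close>, whereas all members
  of a cone reaching past \<open>b\<close> are defined there.\<close>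

lemma nbhd_avoids_node:
  assumes "s \<in> nodes" "x \<in> branches"
  obtains a where "a \<in> Field \<kappa>" "s \<notin> nbhd a x"
proof -
  obtain b where b: "b \<in> Field \<kappa>" "s \<in> level b"
    using assms by (auto simp: nodes_def)
  obtain a where a: "a \<in> Field \<kappa>" "{b} \<subseteq> underS \<kappa> a"
    using bounded_finite[of "{b}"] b by blast
  have "s b = None"
    using b underS_notIn[of b \<kappa>] maps_on_eq_None unfolding level_def by metis
  then have "s \<notin> nbhd a x"
    using branch_eq_Some[OF assms(2) b(1)] a by (auto simp: nbhd_def)
  with a(1) show thesis
    by (rule that)
qed

lemma closedin_node:
  assumes "s \<in> nodes"
  shows "closedin tree_space {s}"
proof -
  have "\<exists>a\<in>Field \<kappa>. nbhd a y \<subseteq> branches \<union> nodes - {s}" if y: "y \<in> branches" for y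
  proof -
    obtain a where "a \<in> Field \<kappa>" "s \<notin> nbhd a y"
      using nbhd_avoids_node[OF assms y] .
    then show ?thesis
      using nbhd_subset[of a y] by blast
  qed
  then show ?thesis
    using assms by (auto simp: closedin_def topspace_tree_space openin_tree_space)
qed

definition tree_base :: "('a \<rightharpoonup> 'b) set set" where
  "tree_base = (\<lambda>s. {s}) ` nodes \<union> (\<lambda>(a, x). nbhd a x) ` (Field \<kappa> \<times> branches)"

lemma base_tree_base: "base tree_space tree_base"
  unfolding base_def
proof (intro conjI allI impI ballI)
  show "openin tree_space B" if "B \<in> tree_base" for B
    using that openin_nbhd openin_node by (auto simp: tree_base_def)
next
  fix U x
  assume U: "openin tree_space U \<and> x \<in> U"
  show "\<exists>B\<in>tree_base. x \<in> B \<and> B \<subseteq> U"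
  proof (cases "x \<in> nodes")
    case True
    with U show ?thesis
      by (intro bexI[of _ "{x}"]) (auto simp: tree_base_def)
  next
    case False
    with U have x: "x \<in> branches"
      by (auto simp: openin_tree_space)
    then obtain a where "a \<in> Field \<kappa>" "nbhd a x \<subseteq> U"
      using U unfolding openin_tree_space by blast
    with x show ?thesis
      by (intro bexI[of _ "nbhd a x"]) (auto simp: tree_base_def mem_nbhd_self)
  qed
qed

lemma zero_dimensional: "zero_dimensional_space tree_space"
  unfolding zero_dimensional_space_def
proof (intro exI conjI ballI)
  show "base tree_space tree_base"
    by (rule base_tree_base)
  show "closedin tree_space B" if "B \<in> tree_base" for B
    using that closedin_nbhd closedin_node by (auto simp: tree_base_def)
qed

lemma Hausdorff: "Hausdorff_space tree_space"
  unfolding Hausdorff_space_def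
proof (intro allI impI)
  fix x y
  assume xy: "x \<in> topspace tree_space \<and> y \<in> topspace tree_space \<and> x \<noteq> y"
  have node: "\<exists>U V. openin tree_space U \<and> openin tree_space V \<and> p \<in> U \<and> q \<in> V \<and> disjnt U V"
    if "p \<in> nodes" "q \<in> topspace tree_space" "p \<noteq> q" for p q
    using that openin_node[of p] closedin_node[of p]
    by (intro exI[of _ "{p}"] exI[of _ "topspace tree_space - {p}"])
      (auto simp: disjnt_def closedin_def)
  show "\<exists>U V. openin tree_space U \<and> openin tree_space V \<and> x \<in> U \<and> y \<in> V \<and> disjnt U V"
  proof (cases "x \<in> nodes \<or> y \<in> nodes")
    case True
    then show ?thesis
      using node[of x y] node[of y x] xy by (metis disjnt_sym)
  next
    case False
    then have br: "x \<in> branches" "y \<in> branches"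
      using xy by (auto simp: topspace_tree_space)
    then obtain b where b: "b \<in> Field \<kappa>" "x b \<noteq> y b"
      using branch_neq xy by metis
    \<comment> \<open>\<open>nbhd a\<close> controls only coordinates strictly below
      \<open>a\<close>, so \<open>a\<close> must lie strictly above \<open>b\<close>.\<close>
    obtain a where a: "a \<in> Field \<kappa>" "{b} \<subseteq> underS \<kappa> a"
      using bounded_finite[of "{b}"] b by blast
    then show ?thesis
      using br b nbhd_disjoint[of b a x y]
      by (intro exI[of _ "nbhd a x"] exI[of _ "nbhd a y"])
        (auto simp: disjnt_def openin_nbhd mem_nbhd_self)
  qed
qed

section \<open>Sizes of levels, nodes and branches\<close>

lemma card_of_branches: "|branches| =o \<Lambda> ^c \<kappa>"
  unfolding branches_def cexp_def by (rule card_of_maps_on)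

lemma card_of_level: "|level a| =o \<Lambda> ^c |underS \<kappa> a|"
  unfolding level_def cexp_def Field_card_of by (rule card_of_maps_on)

lemma cexp_ordLeq_cexp_less:
  fixes \<mu> :: "'a rel"
  assumes "Card_order \<mu>" "\<mu> <o \<kappa>"
  shows "\<Lambda> ^c \<mu> \<le>o cexp_less \<Lambda> \<kappa>"
  unfolding cexp_less_def
  by (rule csup_least_upper_bound(1)) (use assms in \<open>auto simp: Card_order_cexp\<close>)

lemma Card_order_cexp_less: "Card_order (cexp_less \<Lambda> \<kappa>)"
  unfolding cexp_less_def by (rule Card_order_csup)

text \<open>Cantor's theorem: if the supremum were below \<kappa>, it would itself be an admissible
  exponent, and the resulting power, at least that of base 2, would exceed the supremum.\<close>

lemma kappa_ordLeq_cexp_less: "\<kappa> \<le>o cexp_less \<Lambda> \<kappa>"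
proof (rule ccontr)
  let ?W = "cexp_less \<Lambda> \<kappa>"
  assume "\<not> \<kappa> \<le>o ?W"
  then have less: "?W <o \<kappa>"
    using Well_order Card_order_cexp_less not_ordLeq_iff_ordLess card_order_on_well_order_on
    by blast
  then have "|Field ?W| <o \<kappa>"
    by (rule ordLess_Field)
  \<comment> \<open>The exponents in \<open>cexp_less\<close> live on the type of \<kappa>, so
    \<open>?W\<close> needs a copy there.\<close>
  then obtain B :: "'a set" where B: "|Field ?W| =o |B|" "|B| <o \<kappa>"
    using internalize_card_of_ordLess[of "Field ?W" \<kappa>] by blast
  have "|B| <o ctwo ^c |B|"
    by (rule ordLess_ctwo_cexp[OF card_of_Card_order])
  also have "ctwo ^c |B| \<le>o \<Lambda> ^c |B|"
    by (rule cexp_mono1[OF ctwo card_of_Card_order])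
  also have "\<Lambda> ^c |B| \<le>o ?W"
    using B(2) by (intro cexp_ordLeq_cexp_less card_of_Card_order)
  also have "?W =o |B|"
    using B(1) card_of_Field_ordIso[OF Card_order_cexp_less] ordIso_symmetric ordIso_transitive
    by blast
  finally show False
    using ordLess_irreflexive by blast
qed

lemma infinite_cexp_less: "infinite (Field (cexp_less \<Lambda> \<kappa>))"
  using cinfinite_mono[OF kappa_ordLeq_cexp_less] Cinfinite by (simp add: cinfinite_def)

lemma cexp_less_ordLeq:
  fixes B :: "'d set"
  assumes "\<And>\<mu>. Card_order (\<mu> :: 'a rel) \<Longrightarrow> \<mu> <o \<kappa> \<Longrightarrow> \<Lambda> ^c \<mu> \<le>o |B|"
  shows "cexp_less \<Lambda> \<kappa> \<le>o |B|"
  unfolding cexp_less_def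
  by (rule csup_ordLeq) (use assms in \<open>auto simp: Card_order_cexp\<close>)

text \<open>Each level is one of the powers below the supremum, and the number \<kappa> of levels is
  absorbed by \<open>kappa_ordLeq_cexp_less\<close>.\<close>

lemma card_of_nodes_ordLeq: "|nodes| \<le>o cexp_less \<Lambda> \<kappa>"
  unfolding nodes_def
proof (intro card_of_UNION_ordLeq_infinite_Field infinite_cexp_less Card_order_cexp_less ballI)
  show "|Field \<kappa>| \<le>o cexp_less \<Lambda> \<kappa>"
    using card_of_Field_ordIso Cinfinite kappa_ordLeq_cexp_less ordIso_ordLeq_trans by blast
  show "|level a| \<le>o cexp_less \<Lambda> \<kappa>" if "a \<in> Field \<kappa>" for a
  proof (rule ordIso_ordLeq_trans[OF card_of_level])
    have "|underS \<kappa> a| <o \<kappa>"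
      using Cinfinite that by (intro card_of_underS) simp_all
    then show "\<Lambda> ^c |underS \<kappa> a| \<le>o cexp_less \<Lambda> \<kappa>"
      by (rule cexp_ordLeq_cexp_less[OF card_of_Card_order])
  qed
qed

section \<open>The network weight\<close>

text \<open>Network members need not be open, so cones may be cut down to branches. Such a cone
  depends only on a node, whereas \<open>nbhd a x\<close> depends on the whole branch
  \<open>x\<close>.\<close>

definition tree_network :: "('a \<rightharpoonup> 'b) set set" where
  "tree_network =
     (\<lambda>s. {s}) ` nodes \<union> (\<lambda>s. {x \<in> branches. s \<subseteq>\<^sub>m x}) ` nodes"

lemma network_tree_network: "network tree_space tree_network"
  unfolding network_def
proof (intro conjI allI impI ballI)
  show "N \<subseteq> topspace tree_space" if "N \<in> tree_network" for N
    using that by (auto simp: tree_network_def topspace_tree_space)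
next
  fix U x
  assume U: "openin tree_space U \<and> x \<in> U"
  show "\<exists>N\<in>tree_network. x \<in> N \<and> N \<subseteq> U"
  proof (cases "x \<in> nodes")
    case True
    with U show ?thesis
      by (intro bexI[of _ "{x}"]) (auto simp: tree_network_def)
  next
    case False
    with U have x: "x \<in> branches"
      by (auto simp: openin_tree_space)
    then obtain a where a: "a \<in> Field \<kappa>" "nbhd a x \<subseteq> U"
      using U unfolding openin_tree_space by blast
    let ?s = "x |` underS \<kappa> a"
    have "y \<in> nbhd a x" if y: "y \<in> branches" "?s \<subseteq>\<^sub>m y" for y
    proof -
      have "y b = x b" if "b \<in> underS \<kappa> a" for b
      proof -
        have "b \<in> Field \<kappa>"
          using that Order_Relation.underS_Field by fast
        then show ?thesis
          using y(2) that branch_eq_Some[OF x] by (force simp: map_le_def)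
      qed
      then show ?thesis
        using x y(1) branch_in_nbhd_iff by blast
    qed
    moreover have "?s \<in> nodes"
      using restrict_branch[OF x] a(1) by (auto simp: nodes_def)
    moreover have "?s \<subseteq>\<^sub>m x"
      by (auto simp: map_le_def)
    ultimately show ?thesis
      using x a(2)
      by (intro bexI[of _ "{y \<in> branches. ?s \<subseteq>\<^sub>m y}"]) (auto simp: tree_network_def)
  qed
qed

lemma card_of_tree_network: "|tree_network| \<le>o cexp_less \<Lambda> \<kappa>"
  unfolding tree_network_def
  by (intro card_of_Un_ordLeq_infinite_Field infinite_cexp_less Card_order_cexp_less
      ordLeq_transitive[OF card_of_image card_of_nodes_ordLeq])

text \<open>Extend each node \<open>s\<close> to a branch \<open>x s\<close> and choose a network
  member between \<open>x s\<close> and its cone at \<open>a\<close>. If two nodes share a member,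
  each chosen branch lies in the cone of the other, so the nodes agree.\<close>

lemma network_inject_level:
  assumes "network tree_space \<N>" and a: "a \<in> Field \<kappa>"
  shows "|level a| \<le>o |\<N>|"
proof -
  have "\<exists>x N. x \<in> branches \<and> (\<forall>b\<in>underS \<kappa> a. x b = s b) \<and> N \<in> \<N> \<and> x \<in> N \<and> N \<subseteq> nbhd a x"
    if s: "s \<in> level a" for s
  proof -
    obtain x where x: "x \<in> branches" "\<And>b. b \<in> underS \<kappa> a \<Longrightarrow> x b = s b"
      using extend_node[OF s] by blast
    obtain N where "N \<in> \<N>" "x \<in> N" "N \<subseteq> nbhd a x"
      using assms(1) openin_nbhd[OF x(1) a] mem_nbhd_self[OF x(1), of a]
      unfolding network_def by metis
    with x show ?thesis
      by (intro exI[of _ x] exI[of _ N]) simp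
  qed
  then obtain x N where xN: "\<And>s. s \<in> level a \<Longrightarrow> x s \<in> branches \<and>
      (\<forall>b\<in>underS \<kappa> a. x s b = s b) \<and> N s \<in> \<N> \<and> x s \<in> N s \<and> N s \<subseteq> nbhd a (x s)"
    by metis
  have "s = t" if st: "s \<in> level a" "t \<in> level a" "N s = N t" for s t
  proof
    fix b
    have "x s \<in> nbhd a (x t)"
      using xN[OF st(1)] xN[OF st(2)] st(3) by blast
    then have "\<forall>b\<in>underS \<kappa> a. x s b = x t b"
      by (simp add: nbhd_def)
    then show "s b = t b"
      using xN st maps_on_eq_None unfolding level_def by (metis (no_types, lifting))
  qed
  then have "inj_on N (level a)"
    by (auto intro: inj_onI)
  moreover have "N ` level a \<subseteq> \<N>"
    using xN by blast
  ultimately show ?thesis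
    using card_of_ordLeq by blast
qed

lemma cexp_less_ordLeq_network:
  assumes "network tree_space \<N>"
  shows "cexp_less \<Lambda> \<kappa> \<le>o |\<N>|"
proof (rule cexp_less_ordLeq)
  fix \<mu> :: "'a rel"
  assume \<mu>: "Card_order \<mu>" "\<mu> <o \<kappa>"
  \<comment> \<open>A cardinal below \<kappa> is isomorphic to a proper initial segment, so its
    power is the size of a level.\<close>
  then obtain a where a: "a \<in> Field \<kappa>" "\<mu> =o Restr \<kappa> (underS \<kappa> a)"
    using ordLess_iff_ordIso_Restr[of \<kappa> \<mu>] Well_order card_order_on_well_order_on by blast
  have "Field (Restr \<kappa> (underS \<kappa> a)) = underS \<kappa> a"
    using Well_order wo_rel.underS_ofilter[of \<kappa> a] Field_Restr_ofilter
    by (simp add: wo_rel_def)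
  then have "|Field \<mu>| =o |underS \<kappa> a|"
    using card_of_cong[OF a(2)] by simp
  then have "\<mu> =o |underS \<kappa> a|"
    using card_of_Field_ordIso[OF \<mu>(1)] ordIso_symmetric ordIso_transitive by blast
  then have "\<Lambda> ^c \<mu> =o \<Lambda> ^c |underS \<kappa> a|"
    using cexp_cong2 Card_order \<mu>(1) by blast
  also have "\<Lambda> ^c |underS \<kappa> a| =o |level a|"
    by (rule ordIso_symmetric[OF card_of_level])
  also have "|level a| \<le>o |\<N>|"
    by (rule network_inject_level[OF assms a(1)])
  finally show "\<Lambda> ^c \<mu> \<le>o |\<N>|" .
qed

lemma network_weight: "network_weight tree_space =o cexp_less \<Lambda> \<kappa>"
  unfolding network_weight_def
  using network_tree_network card_of_tree_network Card_order_cexp_less cexp_less_ordLeq_network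
  by (intro min_card_eqI[of tree_network]) auto

section \<open>The weight\<close>

lemma infinite_cexp: "infinite (Field (\<Lambda> ^c \<kappa>))"
  using cinfinite_cexp[OF ctwo Cinfinite] by (simp add: cinfinite_def)

lemma cexp_less_ordLeq_cexp: "cexp_less \<Lambda> \<kappa> \<le>o \<Lambda> ^c \<kappa>"
proof -
  have "cexp_less \<Lambda> \<kappa> \<le>o |Field (\<Lambda> ^c \<kappa>)|"
  proof (rule cexp_less_ordLeq)
    fix \<mu> :: "'a rel"
    assume \<mu>: "Card_order \<mu>" "\<mu> <o \<kappa>"
    have "\<Lambda> ^c \<mu> \<le>o \<Lambda> ^c \<kappa>"
    proof (cases "Field \<mu> = {}")
      case True
      \<comment> \<open>Monotonicity in the exponent is applied only to nonempty exponents; the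
        power with exponent 0 is a singleton.\<close>
      have "|{\<lambda>_. undefined}| \<le>o \<Lambda> ^c \<kappa>"
        using infinite_imp_nonempty[OF infinite_cexp]
        by (rule Card_order_singl_ordLeq[OF Card_order_cexp])
      with True show ?thesis
        by (simp add: cexp_def Func_empty)
    next
      case False
      then show ?thesis
        by (intro cexp_mono2'[OF ordLess_imp_ordLeq[OF \<mu>(2)] Card_order]) simp
    qed
    then show "\<Lambda> ^c \<mu> \<le>o |Field (\<Lambda> ^c \<kappa>)|"
      by (simp add: cexp_def Field_card_of)
  qed
  then show ?thesis
    by (simp add: cexp_def Field_card_of)
qed

lemma card_of_tree_base: "|tree_base| \<le>o \<Lambda> ^c \<kappa>"
  unfolding tree_base_def
proof (intro card_of_Un_ordLeq_infinite_Field infinite_cexp Card_order_cexp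
    ordLeq_transitive[OF card_of_image])
  show "|nodes| \<le>o \<Lambda> ^c \<kappa>"
    using card_of_nodes_ordLeq cexp_less_ordLeq_cexp by (rule ordLeq_transitive)
  have "|Field \<kappa>| =o \<kappa>"
    using Cinfinite by (simp add: card_of_Field_ordIso)
  then have "|Field \<kappa>| \<le>o \<Lambda> ^c \<kappa>"
    using ordLeq_cexp2[OF ctwo] Cinfinite ordIso_ordLeq_trans by blast
  then show "|Field \<kappa> \<times> branches| \<le>o \<Lambda> ^c \<kappa>"
    using card_of_Times_ordLeq_infinite_Field[OF infinite_cexp] card_of_branches
      ordIso_imp_ordLeq Card_order_cexp by blast
qed

text \<open>
  Each \<open>x \<in> S\<close> has a cone inside \<open>B\<close>, and the restrictions of the branches to the levels of
  their cones are distinct nodes: if \<open>y \<in> S\<close> lay in the cone of \<open>x \<noteq> y\<close>, then \<open>B\<close> would contain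
  all high nodes on \<open>y\<close>, which \<open>nbhd a y\<close> omits.
\<close>

lemma card_of_shared_nbhd:
  assumes B: "openin tree_space B" and S: "S \<subseteq> branches"
    and sub: "\<And>x. x \<in> S \<Longrightarrow> x \<in> B \<and> B \<subseteq> nbhd a x"
  shows "|S| \<le>o |nodes|"
proof -
  have "\<forall>x\<in>S. \<exists>d\<in>Field \<kappa>. nbhd d x \<subseteq> B"
    using B S sub by (auto simp: openin_tree_space)
  then obtain d where d: "\<And>x. x \<in> S \<Longrightarrow> d x \<in> Field \<kappa> \<and> nbhd (d x) x \<subseteq> B"
    by metis
  let ?r = "\<lambda>x. x |` underS \<kappa> (d x)"
  have "inj_on ?r S"
  proof (rule inj_onI, rule ccontr)
    fix x y
    assume xy: "x \<in> S" "y \<in> S" "?r x = ?r y" "x \<noteq> y"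
    have br: "x \<in> branches" "y \<in> branches"
      using xy S by auto
    have agree: "y b = x b" if "b \<in> underS \<kappa> (d x)" for b
    proof -
      have "b \<in> Field \<kappa>"
        using that Order_Relation.underS_Field by fast
      then obtain v where "x b = Some v"
        using branch_eq_Some br by blast
      then have "?r y b = Some v"
        using xy(3)[symmetric] that by simp
      then show ?thesis
        using \<open>x b = Some v\<close> by (auto simp: restrict_map_def split: if_splits)
    qed
    obtain b where b: "b \<in> Field \<kappa>" "x b \<noteq> y b"
      using branch_neq br xy(4) by metis
    \<comment> \<open>Passing \<open>d x\<close> keeps the node \<open>?s\<close> on
      \<open>y\<close> inside the cone of \<open>x\<close>; passing \<open>b\<close> takes it off
      the branch \<open>x\<close>.\<close>
    obtain c where c: "c \<in> Field \<kappa>" "{d x, b} \<subseteq> underS \<kappa> c"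
      using bounded_finite[of "{d x, b}"] d[OF xy(1)] b by blast
    let ?s = "y |` underS \<kappa> c"
    have node: "?s \<in> nodes"
      using restrict_branch br c by (auto simp: nodes_def)
    have "?s b = y b"
      using c by simp
    moreover obtain v where "y b = Some v"
      using branch_eq_Some br b by blast
    ultimately have "\<not> ?s \<subseteq>\<^sub>m x"
      using b by (metis domI map_le_def)
    moreover have "?s e = x e" if "e \<in> underS \<kappa> (d x)" for e
      using that agree[OF that] underS_mono[of "d x" c] c by auto
    ultimately have "?s \<in> nbhd (d x) x"
      using node by (auto simp: nbhd_def)
    then have "?s \<in> nbhd a y"
      using d[OF xy(1)] sub[OF xy(2)] by blast
    moreover have "?s \<subseteq>\<^sub>m y"
      by (auto simp: map_le_def)
    ultimately have "?s = y"
      by (simp add: nbhd_def)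
    then show False
      using node br branches_nodes_disjoint by auto
  qed
  moreover have "?r ` S \<subseteq> nodes"
    using d S restrict_branch unfolding nodes_def by blast
  ultimately show ?thesis
    using card_of_ordLeq by blast
qed

text \<open>Assign to each branch a base member inside its cone. The fibres have at most
  \<open>|nodes|\<close> elements, hence at most \<open>|\<B>|\<close>, because a base is also a
  network. So the branches form a union of \<open>|\<B>|\<close> sets of size at most
  \<open>|\<B>|\<close>.\<close>

lemma cexp_ordLeq_base:
  assumes B: "base tree_space \<B>"
  shows "\<Lambda> ^c \<kappa> \<le>o |\<B>|"
proof -
  \<comment> \<open>Any \<open>a\<close> will do: what counts is that \<open>nbhd a x\<close> omits
    the nodes on \<open>x\<close>.\<close>
  obtain a where a: "a \<in> Field \<kappa>"
    using infinite_imp_nonempty[OF infinite_Field] by blast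
  have "\<exists>B\<in>\<B>. x \<in> B \<and> B \<subseteq> nbhd a x" if "x \<in> branches" for x
    using B openin_nbhd[OF that a] mem_nbhd_self[OF that, of a] unfolding base_def by simp
  then obtain f where f: "\<And>x. x \<in> branches \<Longrightarrow> f x \<in> \<B> \<and> x \<in> f x \<and> f x \<subseteq> nbhd a x"
    by metis
  have less: "cexp_less \<Lambda> \<kappa> \<le>o |\<B>|"
    by (rule cexp_less_ordLeq_network[OF network_if_base[OF B]])
  have "|{x \<in> branches. f x = b}| \<le>o |\<B>|" if "b \<in> \<B>" for b
  proof -
    have "|{x \<in> branches. f x = b}| \<le>o |nodes|"
      by (rule card_of_shared_nbhd[where B = b and a = a])
        (use that B f in \<open>auto simp: base_def\<close>)
    then show ?thesis
      by (rule ordLeq_transitive[OF _ ordLeq_transitive[OF card_of_nodes_ordLeq less]])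
  qed
  moreover have "infinite \<B>"
    using cinfinite_mono[OF less] infinite_cexp_less by (simp add: cinfinite_def Field_card_of)
  ultimately have "|\<Union>b\<in>\<B>. {x \<in> branches. f x = b}| \<le>o |\<B>|"
    by (intro card_of_UNION_ordLeq_infinite ordLeq_refl card_of_Card_order) auto
  moreover have "(\<Union>b\<in>\<B>. {x \<in> branches. f x = b}) = branches"
    using f by auto
  ultimately show ?thesis
    using ordIso_ordLeq_trans[OF ordIso_symmetric[OF card_of_branches]] by simp
qed

lemma weight: "weight tree_space =o \<Lambda> ^c \<kappa>"
  unfolding weight_def
  using base_tree_base card_of_tree_base Card_order_cexp cexp_ordLeq_base
  by (intro min_card_eqI[of tree_base]) auto

section \<open>The character\<close>

text \<open>Each member contains a cone of \<open>x\<close>. For fewer than \<kappa> members,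
  regularity gives one cone inside all of them, and a strictly smaller cone then contains no
  member.\<close>

lemma kappa_ordLeq_local_base:
  assumes x: "x \<in> branches" and B: "local_base tree_space x \<B>"
  shows "\<kappa> \<le>o |\<B>|"
proof (rule ccontr)
  assume "\<not> \<kappa> \<le>o |\<B>|"
  then have less: "|\<B>| <o \<kappa>"
    using Well_order not_ordLeq_iff_ordLess card_of_Well_order by blast
  have "\<forall>B\<in>\<B>. \<exists>d\<in>Field \<kappa>. nbhd d x \<subseteq> B"
    using B x by (auto simp: local_base_def openin_tree_space)
  then obtain d where d: "\<And>B. B \<in> \<B> \<Longrightarrow> d B \<in> Field \<kappa> \<and> nbhd (d B) x \<subseteq> B"
    by metis
  have "|d ` \<B>| <o \<kappa>"
    using card_of_image less by (rule ordLeq_ordLess_trans)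
  then obtain c where c: "c \<in> Field \<kappa>" "d ` \<B> \<subseteq> underS \<kappa> c"
    using bounded[of "d ` \<B>"] d by blast
  obtain e where e: "e \<in> Field \<kappa>" "{c} \<subseteq> underS \<kappa> e"
    using bounded_finite[of "{c}"] c by blast
  obtain B where B': "B \<in> \<B>" "B \<subseteq> nbhd e x"
    using B openin_nbhd[OF x e(1)] mem_nbhd_self[OF x, of e] unfolding local_base_def by metis
  have "nbhd c x \<subseteq> nbhd (d B) x"
    using c B'(1) by (intro nbhd_mono underS_mono) auto
  with d[OF B'(1)] B'(2) have sub: "nbhd c x \<subseteq> nbhd e x"
    by blast
  \<comment> \<open>Relabelling \<open>x\<close> at \<open>c\<close> alone keeps agreement strictly
    below \<open>c\<close> but breaks it below \<open>e\<close>, since \<open>c\<close> lies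
    strictly below \<open>e\<close>.\<close>
  obtain v where v: "v \<in> Field \<Lambda>" "x c \<noteq> Some v"
    using two_labels by (metis option.inject)
  have y: "x(c \<mapsto> v) \<in> branches"
    using x v(1) c(1) by (auto simp: branches_def maps_on_def ran_def)
  have "x(c \<mapsto> v) \<in> nbhd c x"
    unfolding branch_in_nbhd_iff[OF x y] by (auto simp: underS_def)
  moreover have "x(c \<mapsto> v) \<notin> nbhd e x"
    unfolding branch_in_nbhd_iff[OF x y] using e v(2) by auto
  ultimately show False
    using sub by blast
qed

lemma character_at_branch:
  assumes "x \<in> branches"
  shows "character_at tree_space x =o \<kappa>"
  unfolding character_at_def
proof (rule min_card_eqI)
  show "(\<lambda>a. nbhd a x) ` Field \<kappa> \<in> {\<B>. local_base tree_space x \<B>}"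
    unfolding local_base_def mem_Collect_eq
  proof (intro conjI ballI allI impI)
    fix U
    assume "openin tree_space U \<and> x \<in> U"
    then show "\<exists>B\<in>(\<lambda>a. nbhd a x) ` Field \<kappa>. B \<subseteq> U"
      using assms by (simp add: openin_tree_space)
  qed (use assms openin_nbhd mem_nbhd_self in auto)
  have "|Field \<kappa>| =o \<kappa>"
    using Cinfinite by (simp add: card_of_Field_ordIso)
  then show "|(\<lambda>a. nbhd a x) ` Field \<kappa>| \<le>o \<kappa>"
    using card_of_image ordLeq_ordIso_trans by blast
qed (use assms Cinfinite kappa_ordLeq_local_base in auto)

lemma character_at_node:
  assumes "s \<in> nodes"
  shows "character_at tree_space s \<le>o \<kappa>"
proof -
  have "local_base tree_space s {{s}}"
    using openin_node[OF assms] by (auto simp: local_base_def)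
  then obtain A where A: "character_at tree_space s = |A|" "|A| \<le>o |{{s}}|"
    unfolding character_at_def
    using min_card_attained[of "{\<B>. local_base tree_space s \<B>}"] by blast
  have "|{{s}}| \<le>o \<kappa>"
    using Card_order_singl_ordLeq[of \<kappa>] Cinfinite infinite_Field by fastforce
  with A show ?thesis
    using ordLeq_transitive by metis
qed

lemma character: "character tree_space =o \<kappa>"
proof -
  let ?R = "character_at tree_space ` topspace tree_space"
  have Field: "|Field \<kappa>| =o \<kappa>"
    using Cinfinite by (simp add: card_of_Field_ordIso)
  have card: "Card_order r" if "r \<in> ?R" for r
    using that by (auto simp: character_at_def min_card_def card_of_Card_order)
  have "r \<le>o \<kappa>" if "r \<in> ?R" for r
    using that character_at_branch character_at_node ordIso_imp_ordLeq
    by (auto simp: topspace_tree_space)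
  then have "csup ?R \<le>o |Field \<kappa>|"
    using Field by (intro csup_ordLeq card) (blast intro: ordLeq_ordIso_trans ordIso_symmetric)+
  then have upper: "csup ?R \<le>o \<kappa>"
    using Field by (rule ordLeq_ordIso_trans)
  \<comment> \<open>The supremum is attained at branches, so one must exist.\<close>
  obtain x where x: "x \<in> branches"
    using branches_nonempty by blast
  have "character_at tree_space x \<le>o csup ?R"
    by (rule csup_least_upper_bound(1)[OF card]) (use x in \<open>auto simp: topspace_tree_space\<close>)
  then have "\<kappa> \<le>o csup ?R"
    using character_at_branch[OF x] ordIso_ordLeq_trans ordIso_symmetric by blast
  with upper show ?thesis
    by (simp add: character_def ordIso_iff_ordLeq)
qed

end

text \<open>Two labels are required: otherwise \<open>\<Lambda> ^c \<kappa>\<close> is at most 1,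
  while the character, bounded by the weight, is the infinite cardinal \<kappa>.\<close>

theorem theorem4p1:
  fixes \<kappa> :: "'a rel" and \<Lambda> :: "'b rel"
  assumes "Cinfinite \<kappa>" and "cf \<kappa> =o \<kappa>"
    and "Card_order \<Lambda>" and "ctwo \<le>o \<Lambda>"
  shows "\<exists>D :: ('a \<Rightarrow> 'b option) topology.
           zero_dimensional_space D \<and> Hausdorff_space D \<and>
           character D =o \<kappa> \<and>
           network_weight D =o cexp_less \<Lambda> \<kappa> \<and>
           weight D =o \<Lambda> ^c \<kappa>"
proof -
  interpret regular_tree \<kappa> \<Lambda>
    using assms by unfold_locales
  show ?thesis
    using zero_dimensional Hausdorff character network_weight weight by blast
qed

end
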